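(* There exist infinitely many real quadratic fields $\mathbb{Q}[\sqrt{\delta}]$ each of which contains infinitely many periodic continued fractions $[\overline{a_0,a_1,\dots,a_n}]$ with all $a_i\in\{1,2\}$.
   Context: For positive integers $a_0,\dots,a_n$, $[\overline{a_0,\dots,a_n}]$ denotes the real number whose continued fraction expansion is purely periodic with period $(a_0,\dots,a_n)$. "Infinitely many periodic continued fractions" means infinitely many distinct real numbers of this form (with varying $n$). *)

theory Defs
  imports Complex_Main
begin

text \<open>
  The convergents \<open>[a 0; a 1, \<dots>, a n]\<close> of a continued fraction, by recursion on the tail sequence.
\<close>

fun cf_convergent :: "(nat \<Rightarrow> nat) \<Rightarrow> nat \<Rightarrow> real" where
  "cf_convergent a 0 = real (a 0)"
| "cf_convergent a (Suc n) = real (a 0) + 1 / cf_convergent (\<lambda>k. a (Suc k)) n"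

definition has_cf_expansion :: "real \<Rightarrow> (nat \<Rightarrow> nat) \<Rightarrow> bool" where
  "has_cf_expansion x a \<longleftrightarrow> (\<forall>k. a k > 0) \<and> cf_convergent a \<longlonglongrightarrow> x"

text \<open>
  \<open>is_periodic_cf x as\<close> says that \<open>x\<close> is the purely periodic continued fraction whose (not
  necessarily minimal) period is the nonempty list \<open>as\<close>.
\<close>

definition is_periodic_cf :: "real \<Rightarrow> nat list \<Rightarrow> bool" where
  "is_periodic_cf x as \<longleftrightarrow> as \<noteq> [] \<and> has_cf_expansion x (\<lambda>k. as ! (k mod length as))"

definition rat_adjoin_sqrt :: "nat \<Rightarrow> real set" where
  "rat_adjoin_sqrt \<delta> = {p + q * sqrt (real \<delta>) | p q. p \<in> \<rat> \<and> q \<in> \<rat>}"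

text \<open>
  Real quadratic fields are taken as subfields of the reals; two of them are isomorphic iff they
  are equal as sets, so counting these sets counts the fields.
\<close>

definition real_quadratic_field :: "real set \<Rightarrow> bool" where
  "real_quadratic_field K \<longleftrightarrow>
     (\<exists>\<delta>::nat. sqrt (real \<delta>) \<notin> \<rat> \<and> K = rat_adjoin_sqrt \<delta>)"

end

theory Submission
  imports Defs "HOL-Analysis.Analysis" "HOL-Number_Theory.Fib"
    "HOL-Computational_Algebra.Nth_Powers"
begin

text \<open>
  Let \<open>f\<close> be a Fibonacci number with neighbours \<open>h < f < g\<close>. Multiplication by \<open>f + \<surd>(g h)\<close>, a unit of norm
  \<open>f\<^sup>2 - g h = \<plusminus>1\<close>, corresponds to the expansion of \<open>\<surd>(g / h)\<close>, whose period consists of ones followed by a \<open>2\<close>.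
  Suitable truncations of powers of this expansion are words \<open>w\<close> over \<open>{1, 2}\<close> whose matrix \<open>M\<close> satisfies
  \<open>q\<^sup>2 - det M = g h r\<^sup>2\<close> for \<open>q = v\<^sup>T M v\<close>, \<open>v = (2, 1)\<close>. Folding \<open>w\<close> to the period
  \<open>w, 1, 1, 1, 2, w\<close> reversed, \<open>1, 1, 1, 2\<close> gives a matrix of determinant \<open>1\<close> and trace
  \<open>4 q\<^sup>2 - 2 det M\<close>, hence of discriminant \<open>16 q\<^sup>2 (q\<^sup>2 - det M) = g h (4 q r)\<^sup>2\<close>: all these periods
  belong to the field of \<open>\<surd>(g h)\<close>.

  For infinitely many fields, \<open>f = F\<^sub>m\<close> with \<open>m\<close> even makes \<open>g h = f\<^sup>2 + 1\<close> a nonsquare, and choosing the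
  indices so that each \<open>m\<close> is divisible by \<open>m' \<plusminus> 1\<close> for all earlier \<open>m'\<close> makes these numbers pairwise coprime,
  because \<open>gcd F\<^sub>a F\<^sub>b = F (gcd a b)\<close>.
\<close>

section \<open>Continued fraction expansions\<close>

lemma cf_convergent_ge_first:
  assumes "\<And>k. a k > 0"
  shows "cf_convergent a n \<ge> real (a 0)"
  using assms
proof (induction n arbitrary: a)
  case (Suc n)
  have "cf_convergent (\<lambda>k. a (Suc k)) n \<ge> real (a (Suc 0))"
    using Suc.IH[of "\<lambda>k. a (Suc k)"] Suc.prems by simp
  then have "cf_convergent (\<lambda>k. a (Suc k)) n \<ge> 0"
    by (meson of_nat_0_le_iff order_trans)
  then show ?case by simp
qed simp

lemma cf_convergent_ge_1:
  assumes "\<And>k. a k > 0"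
  shows "cf_convergent a n \<ge> 1"
proof -
  have "a 0 \<ge> 1"
    using assms[of 0] by simp
  then have "real (a 0) \<ge> 1"
    by simp
  with cf_convergent_ge_first[of a n] assms show ?thesis
    by (meson order_trans)
qed

lemma cf_convergent_le:
  assumes "\<And>k. a k > 0"
  shows "cf_convergent a n \<le> real (a 0) + 1"
proof (cases n)
  case (Suc m)
  have "cf_convergent (\<lambda>k. a (Suc k)) m \<ge> 1"
    by (rule cf_convergent_ge_1) (rule assms)
  then show ?thesis
    using Suc by (simp add: divide_le_eq_1)
qed simp

text \<open>The convergents after the first exceed \<open>a 0\<close> by a fixed positive amount, so
  strictness survives the limit.\<close>

lemma has_cf_expansion_gt_first:
  assumes "has_cf_expansion x a"
  shows "x > real (a 0)"
proof -
  have pos: "\<And>k. a k > 0" and lim: "cf_convergent a \<longlonglongrightarrow> x"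
    using assms by (auto simp: has_cf_expansion_def)
  have "real (a 0) + 1 / (real (a 1) + 1) \<le> cf_convergent a (Suc n)" for n
  proof -
    have "cf_convergent (\<lambda>k. a (Suc k)) n \<ge> 1"
      by (rule cf_convergent_ge_1) (rule pos)
    moreover have "cf_convergent (\<lambda>k. a (Suc k)) n \<le> real (a 1) + 1"
      using cf_convergent_le[of "\<lambda>k. a (Suc k)" n] pos by simp
    ultimately show ?thesis
      by (simp add: frac_le)
  qed
  moreover have "(\<lambda>n. cf_convergent a (Suc n)) \<longlonglongrightarrow> x"
    using lim by (rule LIMSEQ_Suc)
  ultimately have "real (a 0) + 1 / (real (a 1) + 1) \<le> x"
    by (intro LIMSEQ_le_const) auto
  moreover have "1 / (real (a 1) + 1) > 0"
    by simp
  ultimately show ?thesis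
    by linarith
qed

lemma has_cf_expansion_tail:
  assumes "has_cf_expansion x a"
  shows "has_cf_expansion (1 / (x - real (a 0))) (\<lambda>k. a (Suc k))"
proof -
  have pos: "\<And>k. a k > 0" and lim: "cf_convergent a \<longlonglongrightarrow> x"
    using assms by (auto simp: has_cf_expansion_def)
  have "(\<lambda>n. 1 / (cf_convergent a (Suc n) - real (a 0))) \<longlonglongrightarrow> 1 / (x - real (a 0))"
    using has_cf_expansion_gt_first[OF assms] LIMSEQ_Suc[OF lim]
    by (intro tendsto_intros) auto
  then have "cf_convergent (\<lambda>k. a (Suc k)) \<longlonglongrightarrow> 1 / (x - real (a 0))"
    by simp
  then show ?thesis
    using pos by (simp add: has_cf_expansion_def)
qed

text \<open>The tail value \<open>1 / (x - a 0)\<close> exceeds \<open>a 1\<close>, hence exceeds 1,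
  which puts \<open>x - a 0\<close> strictly between 0 and 1.\<close>

lemma has_cf_expansion_first_eq_floor:
  assumes "has_cf_expansion x a"
  shows "int (a 0) = \<lfloor>x\<rfloor>"
proof -
  have "a 1 > 0"
    using assms by (simp add: has_cf_expansion_def)
  then have "1 / (x - real (a 0)) > 1"
    using has_cf_expansion_gt_first[OF has_cf_expansion_tail[OF assms]] by simp
  with has_cf_expansion_gt_first[OF assms] have "x - real (a 0) < 1"
    by (simp add: field_simps)
  with has_cf_expansion_gt_first[OF assms] show ?thesis
    by linarith
qed

lemma has_cf_expansion_unique:
  assumes "has_cf_expansion x a" "has_cf_expansion x b"
  shows "a n = b n"
  using assms
proof (induction n arbitrary: x a b)
  case 0
  then show ?case
    using has_cf_expansion_first_eq_floor by (metis of_nat_eq_iff)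
next
  case (Suc n)
  have "a 0 = b 0"
    using has_cf_expansion_first_eq_floor Suc.prems by (metis of_nat_eq_iff)
  then show ?case
    using Suc.IH[of "1 / (x - real (a 0))" "\<lambda>k. a (Suc k)" "\<lambda>k. b (Suc k)"]
      has_cf_expansion_tail[OF Suc.prems(1)] has_cf_expansion_tail[OF Suc.prems(2)]
    by simp
qed

text \<open>Here \<open>y\<close> lists the candidate complete quotients. Prepending a digit divides
  the error by at least \<open>c\<close>, so the convergents approach \<open>y 0\<close>
  geometrically.\<close>

lemma has_cf_expansion_complete_quotients:
  assumes pos: "\<And>k. a k > 0"
    and rec: "\<And>k. y k = real (a k) + 1 / y (Suc k)"
    and ge: "\<And>k. y k \<ge> c" and c: "c > 1"
  shows "has_cf_expansion (y 0) a"
proof -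
  have bound: "\<bar>cf_convergent a n - y 0\<bar> \<le> (1 / c) ^ n"
    if "\<And>k. a k > 0" "\<And>k. y k = real (a k) + 1 / y (Suc k)" "\<And>k. y k \<ge> c" for a y n
    using that
  proof (induction n arbitrary: a y)
    case 0
    have "y (Suc 0) \<ge> c"
      by (rule 0)
    then have "y (Suc 0) > 1"
      using c by simp
    moreover have "y 0 = real (a 0) + 1 / y (Suc 0)"
      by (rule 0)
    ultimately show ?case
      by simp
  next
    case (Suc n)
    define z where "z = cf_convergent (\<lambda>k. a (Suc k)) n"
    have z: "z \<ge> 1"
      unfolding z_def by (rule cf_convergent_ge_1) (rule Suc.prems)
    have y: "y (Suc 0) \<ge> c"
      by (rule Suc.prems)
    have IH: "\<bar>z - y (Suc 0)\<bar> \<le> (1 / c) ^ n"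
      unfolding z_def
      by (rule Suc.IH[of "\<lambda>k. a (Suc k)" "\<lambda>k. y (Suc k)"]) (rule Suc.prems)+
    have pos: "z > 0" "y (Suc 0) > 0"
      using z y c by linarith+
    have "y 0 = real (a 0) + 1 / y (Suc 0)"
      by (rule Suc.prems)
    then have "cf_convergent a (Suc n) - y 0 = 1 / z - 1 / y (Suc 0)"
      by (simp add: z_def)
    also have "\<dots> = (y (Suc 0) - z) / (z * y (Suc 0))"
      using pos by (simp add: diff_frac_eq)
    finally have "\<bar>cf_convergent a (Suc n) - y 0\<bar> = \<bar>z - y (Suc 0)\<bar> / (z * y (Suc 0))"
      using pos by (simp add: abs_mult abs_minus_commute)
    also have "\<dots> \<le> (1 / c) ^ n / c"
    proof (rule frac_le)
      have "1 * c \<le> z * y (Suc 0)"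
        using z y c by (intro mult_mono) auto
      then show "c \<le> z * y (Suc 0)"
        by simp
    qed (use IH c in auto)
    finally show ?case
      by simp
  qed
  have lim: "(\<lambda>n. (1 / c) ^ n) \<longlonglongrightarrow> 0"
    using c by (intro LIMSEQ_realpow_zero) auto
  have "norm (cf_convergent a n - y 0) \<le> (1 / c) ^ n" for n
    unfolding real_norm_def by (rule bound[of a y]) (rule pos rec ge)+
  then have "(\<lambda>n. cf_convergent a n - y 0) \<longlonglongrightarrow> 0"
    using lim by (rule Lim_null_comparison[OF always_eventually[OF allI]])
  then have "cf_convergent a \<longlonglongrightarrow> y 0"
    by (rule LIM_zero_cancel)
  then show ?thesis
    using pos by (simp add: has_cf_expansion_def)
qed

section \<open>Purely periodic expansions as fixed points\<close>

definition cf_apply :: "nat list \<Rightarrow> real \<Rightarrow> real" where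
  "cf_apply as x = foldr (\<lambda>a z. real a + 1 / z) as x"

lemma cf_apply_simps [simp]:
  "cf_apply [] x = x"
  "cf_apply (a # as) x = real a + 1 / cf_apply as x"
  by (simp_all add: cf_apply_def)

lemma cf_apply_pos:
  assumes "\<forall>a\<in>set as. a > 0" "x > 0"
  shows "cf_apply as x > 0"
  using assms by (induction as) (auto intro: add_pos_pos)

text \<open>The suffixes of the period, applied to \<open>x\<close>, are the complete quotients.
  Only finitely many values occur, so their minimum serves as the uniform bound above 1.\<close>

lemma is_periodic_cf_fixed_point:
  assumes ne: "as \<noteq> []" and pos: "\<forall>a\<in>set as. a > 0" and x: "x > 0"
    and fixed: "cf_apply as x = x"
  shows "is_periodic_cf x as"
proof -
  define l where "l = length as"
  define y where "y k = cf_apply (drop (k mod l) as) x" for k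
  have l: "l > 0"
    using ne by (simp add: l_def)
  have rec: "y k = real (as ! (k mod l)) + 1 / y (Suc k)" for k
  proof -
    have "k mod l < l"
      using l by simp
    then have "drop (k mod l) as = as ! (k mod l) # drop (Suc (k mod l)) as"
      by (simp add: l_def Cons_nth_drop_Suc)
    \<comment> \<open>When the period is exhausted the suffix on the right is empty, and
      \<open>fixed\<close> restarts with the full word.\<close>
    moreover have "y (Suc k) = cf_apply (drop (Suc (k mod l)) as) x"
      using fixed by (auto simp: y_def mod_Suc l_def)
    ultimately show ?thesis
      by (simp add: y_def)
  qed
  have ypos: "y k > 0" for k
    unfolding y_def using pos x by (intro cf_apply_pos) (auto dest: in_set_dropD)
  have digit: "as ! (k mod l) > 0" for k
    using pos l by (simp add: l_def)
  have gt: "y k > 1" for k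
    using rec[of k] ypos[of "Suc k"] digit[of k]
    by (smt (verit, best) Suc_leI of_nat_1 of_nat_le_iff One_nat_def zero_less_divide_1_iff)
  define c where "c = Min (y ` {..<l})"
  have "c > 1"
    unfolding c_def using l gt by (subst Min_gr_iff) auto
  moreover have "y k \<ge> c" for k
  proof -
    have "y k = y (k mod l)"
      by (simp add: y_def)
    then show ?thesis
      unfolding c_def using l by (intro Min_le) auto
  qed
  ultimately have "has_cf_expansion (y 0) (\<lambda>k. as ! (k mod l))"
    using digit rec by (intro has_cf_expansion_complete_quotients)
  then show ?thesis
    using ne fixed by (simp add: is_periodic_cf_def y_def l_def)
qed

section \<open>Matrices of continued fractions\<close>

definition mat2 :: "'a \<Rightarrow> 'a \<Rightarrow> 'a \<Rightarrow> 'a \<Rightarrow> ('a::zero)^2^2" where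
  "mat2 a b c d = vector [vector [a, b], vector [c, d]]"

lemma mat2_component [simp]:
  "mat2 a b c d $ 1 $ 1 = a" "mat2 a b c d $ 1 $ 2 = b"
  "mat2 a b c d $ 2 $ 1 = c" "mat2 a b c d $ 2 $ 2 = d"
  by (simp_all add: mat2_def)

lemma matrix2_eq_iff:
  "(A :: 'a^2^2) = B \<longleftrightarrow>
     A$1$1 = B$1$1 \<and> A$1$2 = B$1$2 \<and> A$2$1 = B$2$1 \<and> A$2$2 = B$2$2"
  by (auto simp: vec_eq_iff forall_2)

lemma matrix2_mult_component:
  "((A :: 'a::semiring_1^2^2) ** B) $ i $ j = A$i$1 * B$1$j + A$i$2 * B$2$j"
  by (simp add: matrix_matrix_mult_def sum_2)

fun cf_matrix :: "nat list \<Rightarrow> int^2^2" where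
  "cf_matrix [] = mat 1"
| "cf_matrix (a # as) = mat2 (int a) 1 1 0 ** cf_matrix as"

lemma cf_matrix_append: "cf_matrix (as @ bs) = cf_matrix as ** cf_matrix bs"
  by (induction as) (simp_all add: matrix_mul_assoc)

text \<open>The one-letter factors are symmetric, so reversing their order is transposition.\<close>

lemma cf_matrix_rev: "cf_matrix (rev as) = transpose (cf_matrix as)"
proof (induction as)
  case (Cons a as)
  have "transpose (mat2 (int a) 1 1 0) = mat2 (int a) 1 1 0"
    by (simp add: matrix2_eq_iff transpose_def)
  with Cons show ?case
    by (simp add: cf_matrix_append matrix_transpose_mul)
qed simp

lemma cf_matrix_1112: "cf_matrix [1, 1, 1, 2] = mat2 8 3 5 2"
  by (simp add: matrix2_eq_iff matrix2_mult_component mat_def)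

lemma cf_matrix_1121: "cf_matrix [1, 1, 2, 1] = mat2 7 5 4 3"
  by (simp add: matrix2_eq_iff matrix2_mult_component mat_def)

lemma cf_matrix_replicate_1:
  "cf_matrix (replicate (Suc n) 1) =
     mat2 (int (fib (n + 2))) (int (fib (n + 1))) (int (fib (n + 1))) (int (fib n))"
  by (induction n) (simp_all add: matrix2_eq_iff matrix2_mult_component mat_def)

lemma cf_matrix_pos:
  assumes "as \<noteq> []" "\<forall>a\<in>set as. a > 0"
  shows "cf_matrix as $ 1 $ 1 > 0 \<and> cf_matrix as $ 1 $ 2 > 0 \<and>
    cf_matrix as $ 2 $ 1 > 0 \<and> cf_matrix as $ 2 $ 2 \<ge> 0"
  using assms
proof (induction as)
  case (Cons a as)
  show ?case
  proof (cases "as = []")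
    case True
    then show ?thesis
      using Cons.prems by (simp add: matrix2_mult_component mat_def)
  next
    case False
    then show ?thesis
      using Cons by (auto simp: matrix2_mult_component intro!: add_pos_pos add_pos_nonneg)
  qed
qed simp

lemma cf_apply_eq_moebius:
  assumes "as \<noteq> []" "\<forall>a\<in>set as. a > 0" "x > 0"
  shows "cf_apply as x = (of_int (cf_matrix as $ 1 $ 1) * x + of_int (cf_matrix as $ 1 $ 2)) /
    (of_int (cf_matrix as $ 2 $ 1) * x + of_int (cf_matrix as $ 2 $ 2))"
  using assms
proof (induction as)
  case (Cons a as)
  show ?case
  proof (cases "as = []")
    case True
    then show ?thesis
      using Cons.prems by (simp add: matrix2_mult_component mat_def field_simps)
  next
    case False
    define A B C D where "A = real_of_int (cf_matrix as $ 1 $ 1)"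
      and "B = real_of_int (cf_matrix as $ 1 $ 2)"
      and "C = real_of_int (cf_matrix as $ 2 $ 1)"
      and "D = real_of_int (cf_matrix as $ 2 $ 2)"
    note ABCD = A_def[symmetric] B_def[symmetric] C_def[symmetric] D_def[symmetric]
    have "A > 0" "B > 0" "C > 0" "D \<ge> 0"
      using cf_matrix_pos[OF False] Cons.prems by (auto simp: A_def B_def C_def D_def)
    then have "A * x + B > 0" "C * x + D > 0"
      using \<open>x > 0\<close> by (auto intro!: add_pos_pos add_pos_nonneg)
    moreover have "cf_apply as x = (A * x + B) / (C * x + D)"
      unfolding A_def B_def C_def D_def using Cons False by simp
    then have "1 / cf_apply as x = (C * x + D) / (A * x + B)"
      by simp
    ultimately show ?thesis
      unfolding cf_apply_simps by (simp add: matrix2_mult_component ABCD field_simps)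
  qed
qed simp

text \<open>The fixed point is the positive root of C x^2 + (D - A) x - B, whose discriminant is the
  squared trace minus four times the determinant.\<close>

lemma periodic_cf_in_quadratic_field:
  assumes ne: "as \<noteq> []" and pos: "\<forall>a\<in>set as. a > 0"
    and disc: "(trace (cf_matrix as))\<^sup>2 - 4 * det (cf_matrix as) = int \<delta> * s\<^sup>2"
  shows "\<exists>x \<in> rat_adjoin_sqrt \<delta>. is_periodic_cf x as"
proof -
  define A B C D where "A = real_of_int (cf_matrix as $ 1 $ 1)"
    and "B = real_of_int (cf_matrix as $ 1 $ 2)"
    and "C = real_of_int (cf_matrix as $ 2 $ 1)"
    and "D = real_of_int (cf_matrix as $ 2 $ 2)"
  have ABCD: "A > 0" "B > 0" "C > 0" "D \<ge> 0"
    using cf_matrix_pos[OF ne pos] by (auto simp: A_def B_def C_def D_def)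
  define r where "r = \<bar>of_int s\<bar> * sqrt (real \<delta>)"
  have "(A + D)\<^sup>2 - 4 * (A * D - B * C) =
      real_of_int ((trace (cf_matrix as))\<^sup>2 - 4 * det (cf_matrix as))"
    by (simp add: A_def B_def C_def D_def trace_def sum_2 det_2)
  also have "\<dots> = r\<^sup>2"
    unfolding disc by (simp add: r_def power_mult_distrib)
  finally have r2: "r\<^sup>2 = (A - D)\<^sup>2 + 4 * B * C"
    by (simp add: power2_eq_square algebra_simps)
  have "r \<ge> 0"
    by (simp add: r_def)
  have "r > \<bar>A - D\<bar>"
  proof -
    have "\<bar>A - D\<bar>\<^sup>2 < r\<^sup>2"
      using ABCD r2 by simp
    then show ?thesis
      using \<open>r \<ge> 0\<close> by (rule power2_less_imp_less)
  qed
  define x where "x = (A - D + r) / (2 * C)"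
  have x: "x > 0"
    using \<open>r > \<bar>A - D\<bar>\<close> ABCD by (auto simp: x_def)
  have "r = 2 * C * x - (A - D)"
    using ABCD by (simp add: x_def)
  then have "(2 * C * x - (A - D))\<^sup>2 = (A - D)\<^sup>2 + 4 * B * C"
    using r2 by simp
  then have "4 * C * (C * x * x + D * x) = 4 * C * (A * x + B)"
    by (simp add: power2_eq_square algebra_simps)
  then have root: "C * x * x + D * x = A * x + B"
    using ABCD by simp
  have "C * x + D > 0"
    using ABCD x by (auto intro!: add_pos_nonneg)
  then have "(A * x + B) / (C * x + D) = x"
    using root by (simp add: field_simps)
  then have "cf_apply as x = x"
    using cf_apply_eq_moebius[OF ne pos x] by (simp add: A_def B_def C_def D_def)
  then have "is_periodic_cf x as"
    using is_periodic_cf_fixed_point ne pos x by blast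
  moreover have "x = (A - D) / (2 * C) + \<bar>of_int s\<bar> / (2 * C) * sqrt (real \<delta>)"
    by (simp add: x_def r_def add_divide_distrib)
  moreover have "(A - D) / (2 * C) \<in> \<rat>" "\<bar>of_int s\<bar> / (2 * C) \<in> \<rat>"
    by (auto simp: A_def C_def D_def)
  ultimately show ?thesis
    unfolding rat_adjoin_sqrt_def by blast
qed

section \<open>Infinitely many periods for one discriminant\<close>

text \<open>Consecutive letters 2 are separated by \<open>i + 4\<close> letters 1, as in the
  expansion of the root of g / h.\<close>

definition base_word :: "nat \<Rightarrow> nat \<Rightarrow> nat list" where
  "base_word i k = replicate (Suc i) 1 @ concat (replicate k ([1, 1, 2, 1] @ replicate (Suc i) 1))"

definition period_word :: "nat \<Rightarrow> nat \<Rightarrow> nat list" where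
  "period_word i k = base_word i k @ [1, 1, 1, 2] @ rev (base_word i k) @ [1, 1, 1, 2]"

lemma base_word_Suc:
  "base_word i (Suc k) = base_word i k @ [1, 1, 2, 1] @ replicate (Suc i) 1"
proof -
  \<comment> \<open>\<open>replicate\<close> unfolds in front, whereas the induction on
    \<open>k\<close> needs the new block at the end.\<close>
  have *: "concat (replicate (Suc k) xs) = concat (replicate k xs) @ xs" for xs :: "nat list"
    by (induction k) simp_all
  show ?thesis
    unfolding base_word_def * by simp
qed

lemma set_base_word: "set (base_word i k) \<subseteq> {1, 2}"
  by (auto simp: base_word_def)

lemma set_period_word: "set (period_word i k) \<subseteq> {1, 2}"
  using set_base_word[of i k] by (auto simp: period_word_def)

text \<open>
  Here \<open>(q, g r)\<close> is the first row of the power \<open>k + 1\<close> of the matrix with rows \<open>(f, g)\<close>, \<open>(h, f)\<close>,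
  where \<open>h, f, g\<close> are the Fibonacci numbers of indices \<open>i + 5\<close>, \<open>i + 6\<close>, \<open>i + 7\<close>.
\<close>

lemma cf_matrix_base_word:
  fixes i k :: nat
  defines "g \<equiv> int (fib (i + 7))" and "h \<equiv> int (fib (i + 5))"
  shows "\<exists>q r. 2 * cf_matrix (base_word i k) $1$1 + cf_matrix (base_word i k) $2$1 = 2 * q - g * r \<and>
    2 * cf_matrix (base_word i k) $1$2 + cf_matrix (base_word i k) $2$2 = 2 * g * r - 3 * q \<and>
    det (cf_matrix (base_word i k)) = q\<^sup>2 - g * h * r\<^sup>2"
proof -
  \<comment> \<open>Writing all Fibonacci numbers involved as linear forms in two neighbours turns
    the required identities into polynomial ones.\<close>
  define u v where "u = int (fib i)" and "v = int (fib (i + 1))"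
  define f where "f = 5 * u + 8 * v"
  have g: "g = 8 * u + 13 * v" and h: "h = 3 * u + 5 * v"
    by (simp_all add: u_def v_def g_def h_def numeral_eq_Suc)
  have P: "cf_matrix (replicate (Suc i) 1) = mat2 (u + v) v v u"
    unfolding cf_matrix_replicate_1 by (simp add: u_def v_def add.commute)
  show ?thesis
  proof (induction k)
    case 0
    have mat: "cf_matrix (base_word i 0) = mat2 (u + v) v v u"
      using P by (simp add: base_word_def)
    have "2 * (u + v) + v = 2 * f - g * 1" "2 * v + u = 2 * g * 1 - 3 * f"
      "(u + v) * u - v * v = f\<^sup>2 - g * h * 1\<^sup>2"
      by (simp_all add: f_def g h power2_eq_square algebra_simps)
    then show ?case
      unfolding mat det_2 mat2_component by blast
  next
    case (Suc k)
    define M where "M = cf_matrix (base_word i k)"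
    from Suc obtain q r where qr: "2 * M$1$1 + M$2$1 = 2 * q - g * r"
      "2 * M$1$2 + M$2$2 = 2 * g * r - 3 * q" "det M = q\<^sup>2 - g * h * r\<^sup>2"
      by (auto simp: M_def)
    define N where "N = cf_matrix (base_word i (Suc k))"
    have N: "N = M ** (mat2 7 5 4 3 ** mat2 (u + v) v v u)"
      by (simp only: N_def M_def base_word_Suc cf_matrix_append cf_matrix_1121 P)
    \<comment> \<open>Only the row vector (2, 1) M enters. The new pair replacing (q, r) comes from
      multiplying q + r sqrt(g h) by f + sqrt(g h).\<close>
    have "2 * N$1$1 + N$2$1 =
        (7 * (2 * M$1$1 + M$2$1) + 4 * (2 * M$1$2 + M$2$2)) * (u + v) +
        (5 * (2 * M$1$1 + M$2$1) + 3 * (2 * M$1$2 + M$2$2)) * v"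
      by (simp add: N matrix2_mult_component algebra_simps)
    also have "\<dots> = 2 * (f * q + h * g * r) - g * (q + f * r)"
      unfolding qr by (simp add: f_def g h algebra_simps)
    finally have 1: "2 * N$1$1 + N$2$1 = 2 * (f * q + h * g * r) - g * (q + f * r)" .
    have "2 * N$1$2 + N$2$2 =
        (7 * (2 * M$1$1 + M$2$1) + 4 * (2 * M$1$2 + M$2$2)) * v +
        (5 * (2 * M$1$1 + M$2$1) + 3 * (2 * M$1$2 + M$2$2)) * u"
      by (simp add: N matrix2_mult_component algebra_simps)
    also have "\<dots> = 2 * g * (q + f * r) - 3 * (f * q + h * g * r)"
      unfolding qr by (simp add: f_def g h algebra_simps)
    finally have 2: "2 * N$1$2 + N$2$2 = 2 * g * (q + f * r) - 3 * (f * q + h * g * r)" .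
    have "det N = det M * ((u + v) * u - v * v)"
      unfolding N det_mul by (simp add: det_2)
    also have "(u + v) * u - v * v = f\<^sup>2 - g * h"
      by (simp add: f_def g h power2_eq_square algebra_simps)
    also have "det M * (f\<^sup>2 - g * h) = (f * q + h * g * r)\<^sup>2 - g * h * (q + f * r)\<^sup>2"
      unfolding qr by (simp add: power2_eq_square algebra_simps)
    finally show ?case
      using 1 2 unfolding N_def by blast
  qed
qed

text \<open>
  With \<open>v = (2, 1)\<close> the matrix of \<open>[1, 1, 1, 2]\<close> is \<open>2 v v\<^sup>T\<close> plus the antisymmetric matrix \<open>S\<close> with
  rows \<open>(0, -1)\<close>, \<open>(1, 0)\<close>, and \<open>M S M\<^sup>T = det M S\<close>; so the trace depends on \<open>v\<^sup>T M v\<close> and \<open>det M\<close> only.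
\<close>

lemma trace_folded:
  fixes M :: "int^2^2"
  shows "trace (M ** (mat2 8 3 5 2 ** (transpose M ** mat2 8 3 5 2))) =
    4 * (2 * (2 * M$1$1 + M$2$1) + (2 * M$1$2 + M$2$2))\<^sup>2 - 2 * det M"
  by (simp add: trace_def sum_2 det_2 matrix2_mult_component transpose_def
      power2_eq_square algebra_simps)

lemma discriminant_period_word:
  "\<exists>s. (trace (cf_matrix (period_word i k)))\<^sup>2 - 4 * det (cf_matrix (period_word i k)) =
    int (fib (i + 5) * fib (i + 7)) * s\<^sup>2"
proof -
  define M where "M = cf_matrix (base_word i k)"
  define g h where "g = int (fib (i + 7))" and "h = int (fib (i + 5))"
  obtain q r where qr: "2 * M$1$1 + M$2$1 = 2 * q - g * r"
      "2 * M$1$2 + M$2$2 = 2 * g * r - 3 * q" and det: "det M = q\<^sup>2 - g * h * r\<^sup>2"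
    using cf_matrix_base_word[of i k] by (auto simp: M_def g_def h_def)
  have W: "cf_matrix (period_word i k) = M ** (mat2 8 3 5 2 ** (transpose M ** mat2 8 3 5 2))"
    by (simp only: period_word_def M_def cf_matrix_append cf_matrix_rev cf_matrix_1112)
  \<comment> \<open>The squared form is 2 (2 q - g r) + (2 g r - 3 q) = q.\<close>
  have tr: "trace (cf_matrix (period_word i k)) = 4 * q\<^sup>2 - 2 * det M"
    unfolding W trace_folded qr by simp
  have det_W: "det (cf_matrix (period_word i k)) = (det M)\<^sup>2"
  proof -
    have "det (mat2 8 3 5 2 :: int^2^2) = 1"
      by (simp add: det_2)
    then show ?thesis
      by (simp add: W det_mul power2_eq_square)
  qed
  have "(trace (cf_matrix (period_word i k)))\<^sup>2 - 4 * det (cf_matrix (period_word i k)) =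
      16 * q\<^sup>2 * (q\<^sup>2 - det M)"
    unfolding tr det_W by (simp add: power2_eq_square algebra_simps)
  also have "\<dots> = int (fib (i + 5) * fib (i + 7)) * (4 * q * r)\<^sup>2"
    by (simp add: det g_def h_def power2_eq_square algebra_simps)
  finally show ?thesis by blast
qed

text \<open>After the common prefix \<open>base_word i k\<close>, one word continues with 1, 1, 1, 2
  and the other with the block 1, 1, 2, 1.\<close>

lemma period_word_nth_differ:
  fixes i k l :: nat
  assumes "k < l"
  defines "n \<equiv> length (base_word i k) + 2"
  shows "n < length (period_word i k)" "n < length (period_word i l)"
    "period_word i k ! n \<noteq> period_word i l ! n"
proof -
  have "\<exists>zs. base_word i l = base_word i k @ [1, 1, 2] @ zs"
    using assms(1)
  proof (induction l)
    case (Suc l)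
    then show ?case
      by (cases "k = l") (auto simp: base_word_Suc)
  qed simp
  then obtain zs where "base_word i l = base_word i k @ [1, 1, 2] @ zs" ..
  then show "n < length (period_word i k)" "n < length (period_word i l)"
    "period_word i k ! n \<noteq> period_word i l ! n"
    by (simp_all add: period_word_def n_def nth_append)
qed

text \<open>Different words may be repetitions of the same shorter period, so the numbers are told
  apart by a digit. Its position lies inside both words, where reduction modulo the length changes
  nothing.\<close>

lemma infinite_periodic_cf_in_fib_field:
  "infinite {x \<in> rat_adjoin_sqrt (fib (i + 5) * fib (i + 7)).
     \<exists>as. set as \<subseteq> {1, 2} \<and> is_periodic_cf x as}"
proof -
  let ?K = "rat_adjoin_sqrt (fib (i + 5) * fib (i + 7))"
  have "\<exists>x. x \<in> ?K \<and> is_periodic_cf x (period_word i k)" for k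
  proof -
    have "period_word i k \<noteq> []" "\<forall>a\<in>set (period_word i k). a > 0"
      using set_period_word[of i k] by (auto simp: period_word_def)
    then show ?thesis
      using discriminant_period_word[of i k] periodic_cf_in_quadratic_field by blast
  qed
  then obtain x where x: "\<And>k. x k \<in> ?K" "\<And>k. is_periodic_cf (x k) (period_word i k)"
    by metis
  have "x k \<noteq> x l" if "k < l" for k l
  proof
    assume eq: "x k = x l"
    have "has_cf_expansion (x k) (\<lambda>n. period_word i k ! (n mod length (period_word i k)))"
      "has_cf_expansion (x k) (\<lambda>n. period_word i l ! (n mod length (period_word i l)))"
      using x(2)[of k] x(2)[of l] eq by (simp_all add: is_periodic_cf_def)
    from has_cf_expansion_unique[OF this, of "length (base_word i k) + 2"] show False
      using period_word_nth_differ[OF that, of i] by simp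
  qed
  then have "inj x"
    by (intro linorder_injI) auto
  then have "infinite (range x)"
    by (simp add: finite_image_iff)
  moreover have "range x \<subseteq> {x \<in> ?K. \<exists>as. set as \<subseteq> {1, 2} \<and> is_periodic_cf x as}"
    using x set_period_word by blast
  ultimately show ?thesis
    using finite_subset by blast
qed

section \<open>Infinitely many fields\<close>

lemma sqrt_nat_rational_imp_square:
  assumes "sqrt (real n) \<in> \<rat>"
  shows "is_nth_power 2 n"
proof -
  obtain a b where b: "b \<noteq> 0" and ab: "\<bar>sqrt (real n)\<bar> = real a / real b"
    using Rats_abs_nat_div_natE[OF assms] by metis
  have "real n = (real a / real b)\<^sup>2"
    unfolding ab[symmetric] by simp
  then have "real (n * b\<^sup>2) = real (a\<^sup>2)"
    using b by (simp add: field_simps)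
  then have eq: "n * b\<^sup>2 = a\<^sup>2"
    by (simp only: of_nat_eq_iff)
  then have "b dvd a"
    by (metis dvd_triv_right pow_divides_pow_iff zero_less_numeral)
  then obtain c where "a = b * c" ..
  then have "n = c\<^sup>2"
    using eq b by (simp add: power_mult_distrib)
  then show ?thesis
    by (auto simp: is_nth_power_def)
qed

text \<open>Squaring sqrt m = p + q sqrt n forces p q = 0, and irrationality of sqrt m leaves p = 0.
  Then m n is a square, and by coprimality so is m.\<close>

lemma rat_adjoin_sqrt_neq:
  assumes cop: "coprime m n" and m: "sqrt (real m) \<notin> \<rat>" and n: "sqrt (real n) \<notin> \<rat>"
  shows "rat_adjoin_sqrt m \<noteq> rat_adjoin_sqrt n"
proof
  assume eq: "rat_adjoin_sqrt m = rat_adjoin_sqrt n"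
  have "sqrt (real m) = 0 + 1 * sqrt (real m) \<and> (0::real) \<in> \<rat> \<and> (1::real) \<in> \<rat>"
    by simp
  then have "sqrt (real m) \<in> rat_adjoin_sqrt m"
    unfolding rat_adjoin_sqrt_def mem_Collect_eq by (intro exI)
  then have "sqrt (real m) \<in> rat_adjoin_sqrt n"
    unfolding eq .
  then have "\<exists>p q. sqrt (real m) = p + q * sqrt (real n) \<and> p \<in> \<rat> \<and> q \<in> \<rat>"
    unfolding rat_adjoin_sqrt_def by (rule CollectD)
  then obtain p q where sm: "sqrt (real m) = p + q * sqrt (real n)" and pq: "p \<in> \<rat>" "q \<in> \<rat>"
    by metis
  have "(sqrt (real m))\<^sup>2 = (p + q * sqrt (real n))\<^sup>2"
    by (simp only: sm)
  then have *: "2 * p * q * sqrt (real n) = real m - p\<^sup>2 - q\<^sup>2 * real n"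
    by (simp add: power2_eq_square algebra_simps)
  have "p * q = 0"
  proof (rule ccontr)
    assume "p * q \<noteq> 0"
    then have "sqrt (real n) = (real m - p\<^sup>2 - q\<^sup>2 * real n) / (2 * p * q)"
      by (subst eq_divide_eq) (use * \<open>p * q \<noteq> 0\<close> in \<open>simp add: mult.commute\<close>)
    also have "\<dots> \<in> \<rat>"
      using pq by (intro Rats_divide Rats_diff Rats_mult Rats_power) auto
    finally show False
      using n by simp
  qed
  moreover have "q \<noteq> 0"
  proof
    assume "q = 0"
    then have "sqrt (real m) = p"
      unfolding sm by simp
    with m pq show False by simp
  qed
  ultimately have "p = 0"
    by simp
  then have "sqrt (real m) = q * sqrt (real n)"
    unfolding sm by simp
  then have "sqrt (real (m * n)) = q * (sqrt (real n) * sqrt (real n))"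
    by (simp only: of_nat_mult real_sqrt_mult mult.assoc)
  also have "\<dots> = q * real n"
    by simp
  also have "\<dots> \<in> \<rat>"
    using pq by (intro Rats_mult) auto
  finally have "is_nth_power 2 (m * n)"
    by (rule sqrt_nat_rational_imp_square)
  then have "is_nth_power 2 m"
    using is_nth_power_mult_coprime_nat_iff[OF cop] by simp
  then obtain c where "m = c\<^sup>2"
    by (rule is_nth_powerE)
  then show False
    using m by simp
qed

section \<open>Nonsquare and pairwise coprime products of Fibonacci numbers\<close>

lemma sqrt_fib_product_irrational:
  assumes "even m" "m \<ge> 1"
  shows "sqrt (real (fib (m - 1) * fib (m + 1))) \<notin> \<rat>"
proof
  obtain j where j: "m = Suc j" "odd j"
    using assms by (cases m) auto
  define F where "F = fib m"
  have "F > 0"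
    using assms by (simp add: F_def fib_neq_0_nat)
  have eq: "fib (m - 1) * fib (m + 1) = F\<^sup>2 + 1"
    using fib_Cassini_nat[of j] j by (simp add: F_def mult.commute)
  assume "sqrt (real (fib (m - 1) * fib (m + 1))) \<in> \<rat>"
  then have "is_nth_power 2 (fib (m - 1) * fib (m + 1))"
    by (rule sqrt_nat_rational_imp_square)
  then obtain c where "F\<^sup>2 + 1 = c\<^sup>2"
    unfolding eq by (rule is_nth_powerE)
  \<comment> \<open>The upper bound needs \<open>F > 0\<close>; the square would lie strictly
    between consecutive squares.\<close>
  then have "F\<^sup>2 < c\<^sup>2" "c\<^sup>2 < (F + 1)\<^sup>2"
    using \<open>F > 0\<close> by (simp_all add: power2_eq_square algebra_simps)
  then have "F < c" "c < F + 1"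
    by (auto dest: power_less_imp_less_base)
  then show False by simp
qed

text \<open>The factor \<open>fib_index n\<close> passes on all divisors collected so far. The start
  6 makes every index even and at least 6, hence of the form \<open>i + 6\<close> as the words
  require.\<close>

fun fib_index :: "nat \<Rightarrow> nat" where
  "fib_index 0 = 6"
| "fib_index (Suc n) = fib_index n * ((fib_index n - 1) * (fib_index n + 1))"

lemma fib_index_ge: "fib_index n \<ge> 6"
proof (induction n)
  case (Suc n)
  then have "(fib_index n - 1) * (fib_index n + 1) \<ge> 1"
    by simp
  then have "fib_index n * ((fib_index n - 1) * (fib_index n + 1)) \<ge> fib_index n * 1"
    by (rule mult_le_mono2)
  then have "fib_index n \<le> fib_index (Suc n)"
    by (simp only: fib_index.simps mult_1_right)
  with Suc show ?case by linarith
qed simp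

lemma even_fib_index: "even (fib_index n)"
  by (induction n) auto

lemma fib_index_dvd:
  assumes "m < n"
  shows "(fib_index m - 1) * (fib_index m + 1) dvd fib_index n"
  using assms
proof (induction n)
  case (Suc n)
  then show ?case
    by (cases "m = n") auto
qed simp

lemma coprime_fib_products:
  assumes "m < n"
  shows "coprime (fib (fib_index m - 1) * fib (fib_index m + 1))
    (fib (fib_index n - 1) * fib (fib_index n + 1))"
proof -
  \<comment> \<open>A divisor of \<open>fib_index n\<close> is coprime to both neighbours of
    \<open>fib_index n\<close>, so the gcd of the Fibonacci numbers is
    \<open>fib 1 = 1\<close>.\<close>
  have *: "coprime (fib a) (fib b)" if "a dvd fib_index n" "b = fib_index n - 1 \<or> b = fib_index n + 1"
    for a b
  proof -
    have "coprime (fib_index n) b"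
      using that(2) fib_index_ge[of n] coprime_diff_one_right_nat[of "fib_index n"] by auto
    then have "gcd a b = 1"
      using that(1) coprime_divisors by (metis coprime_iff_gcd_eq_1 dvd_refl)
    then show ?thesis
      by (metis coprime_iff_gcd_eq_1 fib_1 fib_gcd)
  qed
  have "fib_index m - 1 dvd fib_index n" "fib_index m + 1 dvd fib_index n"
    using fib_index_dvd[OF assms] by (meson dvd_mult_left dvd_mult_right)+
  then show ?thesis
    using * by simp
qed

theorem mainTheorem2:
  "infinite {K. real_quadratic_field K \<and>
     infinite {x \<in> K. \<exists>as. set as \<subseteq> {1, 2} \<and> is_periodic_cf x as}}"
proof -
  define \<delta> where "\<delta> n = fib (fib_index n - 1) * fib (fib_index n + 1)" for n
  have irrat: "sqrt (real (\<delta> n)) \<notin> \<rat>" for n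
    unfolding \<delta>_def using even_fib_index fib_index_ge[of n]
    by (intro sqrt_fib_product_irrational) auto
  have "rat_adjoin_sqrt (\<delta> m) \<noteq> rat_adjoin_sqrt (\<delta> n)" if "m < n" for m n
    using coprime_fib_products[OF that] irrat
    by (intro rat_adjoin_sqrt_neq) (auto simp: \<delta>_def)
  then have "inj (\<lambda>n. rat_adjoin_sqrt (\<delta> n))"
    by (intro linorder_injI) auto
  then have inf: "infinite (range (\<lambda>n. rat_adjoin_sqrt (\<delta> n)))"
    by (simp add: finite_image_iff)
  have "real_quadratic_field (rat_adjoin_sqrt (\<delta> n))" for n
    using irrat by (auto simp: real_quadratic_field_def)
  moreover have "infinite {x \<in> rat_adjoin_sqrt (\<delta> n). \<exists>as. set as \<subseteq> {1, 2} \<and> is_periodic_cf x as}"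
    for n
  proof -
    obtain i where "fib_index n = i + 6"
      using fib_index_ge[of n] by (metis add.commute le_Suc_ex)
    then show ?thesis
      using infinite_periodic_cf_in_fib_field[of i] by (simp add: \<delta>_def add.commute)
  qed
  ultimately have "range (\<lambda>n. rat_adjoin_sqrt (\<delta> n)) \<subseteq> {K. real_quadratic_field K \<and>
      infinite {x \<in> K. \<exists>as. set as \<subseteq> {1, 2} \<and> is_periodic_cf x as}}"
    by blast
  with inf show ?thesis
    by (rule infinite_super[rotated])
qed

end
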